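(* Let $\mathcal A\subseteq\mathbb N$, $L$ an environment and $T,U$ terms. If $L\vdash_{\mathcal A}T:U$, then there exists an arity $A$ such that $L\vdash T::A$ and $L\vdash U::A$.
   Context: Fix a nonempty set $\Sigma$ of sorts with decidable equality, an arbitrary function $\mathrm{next}:\Sigma\to\Sigma$, and a countably infinite set of variables. Terms and environments: $T,U,V,W ::= \star s \mid x \mid \mathrm{app}(V,T) \mid \lambda x{:}W.\,T \mid \mathrm{def}(x{=}V).\,T \mid \mathrm{cast}(U,T)$ ($s\in\Sigma$) and $L,K ::= \emptyset \mid K,x{:}W \mid K,x{=}V$. $\mathrm{app}(V,T)$ applies $T$ to $V$; $\lambda x{:}W.\,T$ (de Bruijn's abstraction) and $\mathrm{def}(x{=}V).\,T$ (local definition) bind $x$ in $T$; $\mathrm{cast}(U,T)$ annotates $T$ with expected type $U$; entries $x{:}W$ and $x{=}V$ bind $x$. Terms are modulo renaming of bound variables. Write $\mathsf{B}x[V]$ for either $\lambda x{:}V$ or $\mathrm{def}(x{=}V)$ and correspondingly $L,x[V]$ for $L,x{:}V$ resp. $L,x{=}V$. One step of bound rt-reduction $L\vdash T_1\to^nT_2$ is the smallest relation closed under: $L\vdash\mathrm{app}(V,\lambda x{:}W.\,T)\to^0\mathrm{def}(x{=}\mathrm{cast}(W,V)).\,T$; $K,x{=}V\vdash x\to^0V$; $L\vdash\mathrm{def}(x{=}V).\,T\to^0T$ if $x$ not free in $T$; $L\vdash\mathrm{app}(V,\mathrm{def}(x{=}W).\,T)\to^0\mathrm{def}(x{=}W).\,\mathrm{app}(V,T)$;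 $L\vdash\mathrm{cast}(U,T)\to^0T$; $L\vdash\star s\to^1\star\,\mathrm{next}(s)$; $K,x{:}W\vdash x\to^1W$; $L\vdash\mathrm{cast}(U,T)\to^1U$; if $K\vdash x\to^nT$, $y\neq x$, $y$ not free in $T$ then $K,y[V]\vdash x\to^nT$; if $L\vdash V_1\to^0V_2$ then $L\vdash\mathrm{app}(V_1,T)\to^0\mathrm{app}(V_2,T)$; if $L\vdash T_1\to^nT_2$ then $L\vdash\mathrm{app}(V,T_1)\to^n\mathrm{app}(V,T_2)$; if $L\vdash V_1\to^0V_2$ then $L\vdash\mathsf Bx[V_1].\,T\to^0\mathsf Bx[V_2].\,T$; if $L,x[V]\vdash T_1\to^nT_2$ then $L\vdash\mathsf Bx[V].\,T_1\to^n\mathsf Bx[V].\,T_2$; if $L\vdash U_1\to^0U_2$ then $L\vdash\mathrm{cast}(U_1,T)\to^0\mathrm{cast}(U_2,T)$; if $L\vdash T_1\to^0T_2$ then $L\vdash\mathrm{cast}(U,T_1)\to^0\mathrm{cast}(U,T_2)$; if $L\vdash U_1\to^1U_2$ and $L\vdash T_1\to^1T_2$ then $L\vdash\mathrm{cast}(U_1,T_1)\to^1\mathrm{cast}(U_2,T_2)$. $L\vdash T_1\to^{*n}T_2$ is the smallest relation with $L\vdash T\to^{*0}T$, containing single steps, and with $L\vdash T_1\to^{*n_1}T$, $L\vdash T\to^{*n_2}T_2$ implying $L\vdash T_1\to^{*n_1+n_2}T_2$. Validity $L\vdash_{\mathcal A}T$ is the smallest predicate closed under: $L\vdash_{\mathcal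 A}\star s$; if $K\vdash_{\mathcal A}V$ then $K,x[V]\vdash_{\mathcal A}x$; if $K\vdash_{\mathcal A}x$ and $y\neq x$ then $K,y[V]\vdash_{\mathcal A}x$; if $L\vdash_{\mathcal A}V$ and $L,x[V]\vdash_{\mathcal A}T$ then $L\vdash_{\mathcal A}\mathsf Bx[V].\,T$; if $L\vdash_{\mathcal A}U$, $L\vdash_{\mathcal A}T$ and some $U_0$ satisfies $L\vdash T\to^{*1}U_0$, $L\vdash U\to^{*0}U_0$, then $L\vdash_{\mathcal A}\mathrm{cast}(U,T)$; if $L\vdash_{\mathcal A}V$, $L\vdash_{\mathcal A}T$ and there are $n\in\mathcal A$, $x,W_0,U_0$ with $L\vdash T\to^{*n}\lambda x{:}W_0.\,U_0$ and $L\vdash V\to^{*1}W_0$, then $L\vdash_{\mathcal A}\mathrm{app}(V,T)$. The type judgment $L\vdash_{\mathcal A}T:U$ means $L\vdash_{\mathcal A}\mathrm{cast}(U,T)$. Arities are $A,B::=\circ\mid B\Rightarrow A$. Arity assignment $L\vdash T::A$ is the smallest relation closed under: $L\vdash\star s::\circ$; if $K\vdash V::A$ then $K,x[V]\vdash x::A$; if $K\vdash x::A$ and $y\neq x$ then $K,y[V]\vdash x::A$; if $L\vdash W::B$ and $L,x{:}W\vdash T::A$ then $L\vdash\lambda x{:}W.\,T::B\Rightarrow A$; if $L\vdash V::B$ and $L,x{=}V\vdash T::A$ then $L\vdash\mathrm{def}(x{=}V).\,T::A$; if $L\vdash V::B$ and $L\vdash T::B\Rightarrow A$ then $L\vdash\mathrm{app}(V,T)::A$;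 if $L\vdash U::A$ and $L\vdash T::A$ then $L\vdash\mathrm{cast}(U,T)::A$. *)

theory Defs
  imports Main
begin

text \<open>
  Terms modulo renaming of bound variables are represented with de Bruijn indices. The entries
  of an environment bind too, so a variable declared in an environment is the index counting the
  entries to the right of its own one, and environments are likewise taken up to renaming: they
  never bind the same variable twice. An environment is a list whose head is the rightmost entry,
  i.e. \<open>K, x[V]\<close> is \<open>(b, V) # K\<close>. Indices not less than the length of the
  environment stand for the variables that it does not bind.

  The sorts are the elements of an arbitrary type (HOL types are nonempty and equality is
  classical).
\<close>

datatype bind_kind =
    Abst   \<comment> \<open>\<open>\<lambda>x:V\<close> in terms, \<open>x:V\<close> in environments\<close>
  | Abbr   \<comment> \<open>\<open>def(x=V)\<close> in terms, \<open>x=V\<close> in environments\<close>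

datatype 's trm =
    Sort 's
  | Var nat
  | App "'s trm" "'s trm"          \<comment> \<open>\<open>App V T\<close> applies \<open>T\<close> to \<open>V\<close>\<close>
  | Bind bind_kind "'s trm" "'s trm"  \<comment> \<open>only the last argument is in the scope of the binder\<close>
  | Cast "'s trm" "'s trm"         \<comment> \<open>\<open>Cast U T\<close> annotates \<open>T\<close> with expected type \<open>U\<close>\<close>

abbreviation Lam :: "'s trm \<Rightarrow> 's trm \<Rightarrow> 's trm" where
  "Lam W T \<equiv> Bind Abst W T"

abbreviation Def :: "'s trm \<Rightarrow> 's trm \<Rightarrow> 's trm" where
  "Def V T \<equiv> Bind Abbr V T"

type_synonym 's env = "(bind_kind \<times> 's trm) list"

text \<open>
  \<open>shift d T\<close> makes room for a fresh variable with index \<open>d\<close>. A term in the scope of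
  one more binder that does not have the bound variable free is exactly a term of the form
  \<open>shift 0 T\<close>. Hence \<open>shift 0\<close> renders both the side conditions of the form
  ``not free in'' and the passage of an unchanged named term under a binder.
\<close>

primrec shift :: "nat \<Rightarrow> 's trm \<Rightarrow> 's trm" where
  "shift d (Sort s) = Sort s"
| "shift d (Var i) = Var (if i < d then i else Suc i)"
| "shift d (App V T) = App (shift d V) (shift d T)"
| "shift d (Bind b V T) = Bind b (shift d V) (shift (Suc d) T)"
| "shift d (Cast U T) = Cast (shift d U) (shift d T)"

text \<open>\<open>rt_step nxt L n T\<^sub>1 T\<^sub>2\<close> is \<open>L \<turnstile> T\<^sub>1 \<rightarrow>\<^sup>n T\<^sub>2\<close>.\<close>

inductive rt_step :: "('s \<Rightarrow> 's) \<Rightarrow> 's env \<Rightarrow> nat \<Rightarrow> 's trm \<Rightarrow> 's trm \<Rightarrow> bool"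
  for nxt :: "'s \<Rightarrow> 's" where
  beta: "rt_step nxt L 0 (App V (Lam W T)) (Def (Cast W V) T)"
| delta: "rt_step nxt ((Abbr, V) # K) 0 (Var 0) (shift 0 V)"
| zeta: "rt_step nxt L 0 (Def V (shift 0 T)) T"
| theta: "rt_step nxt L 0 (App V (Def W T)) (Def W (App (shift 0 V) T))"
| eps: "rt_step nxt L 0 (Cast U T) T"
| sort: "rt_step nxt L 1 (Sort s) (Sort (nxt s))"
| decl: "rt_step nxt ((Abst, W) # K) 1 (Var 0) (shift 0 W)"
| cast_type: "rt_step nxt L 1 (Cast U T) U"
| var: "rt_step nxt K n (Var i) T \<Longrightarrow> rt_step nxt ((b, V) # K) n (Var (Suc i)) (shift 0 T)"
| app_left: "rt_step nxt L 0 V\<^sub>1 V\<^sub>2 \<Longrightarrow> rt_step nxt L 0 (App V\<^sub>1 T) (App V\<^sub>2 T)"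
| app_right: "rt_step nxt L n T\<^sub>1 T\<^sub>2 \<Longrightarrow> rt_step nxt L n (App V T\<^sub>1) (App V T\<^sub>2)"
| bind_left: "rt_step nxt L 0 V\<^sub>1 V\<^sub>2 \<Longrightarrow> rt_step nxt L 0 (Bind b V\<^sub>1 T) (Bind b V\<^sub>2 T)"
| bind_right: "rt_step nxt ((b, V) # L) n T\<^sub>1 T\<^sub>2 \<Longrightarrow> rt_step nxt L n (Bind b V T\<^sub>1) (Bind b V T\<^sub>2)"
| cast_left: "rt_step nxt L 0 U\<^sub>1 U\<^sub>2 \<Longrightarrow> rt_step nxt L 0 (Cast U\<^sub>1 T) (Cast U\<^sub>2 T)"
| cast_right: "rt_step nxt L 0 T\<^sub>1 T\<^sub>2 \<Longrightarrow> rt_step nxt L 0 (Cast U T\<^sub>1) (Cast U T\<^sub>2)"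
| cast_both: "rt_step nxt L 1 U\<^sub>1 U\<^sub>2 \<Longrightarrow> rt_step nxt L 1 T\<^sub>1 T\<^sub>2 \<Longrightarrow>
    rt_step nxt L 1 (Cast U\<^sub>1 T\<^sub>1) (Cast U\<^sub>2 T\<^sub>2)"

inductive rt_steps :: "('s \<Rightarrow> 's) \<Rightarrow> 's env \<Rightarrow> nat \<Rightarrow> 's trm \<Rightarrow> 's trm \<Rightarrow> bool"
  for nxt :: "'s \<Rightarrow> 's" where
  refl: "rt_steps nxt L 0 T T"
| step: "rt_step nxt L n T\<^sub>1 T\<^sub>2 \<Longrightarrow> rt_steps nxt L n T\<^sub>1 T\<^sub>2"
| trans: "rt_steps nxt L n\<^sub>1 T\<^sub>1 T \<Longrightarrow> rt_steps nxt L n\<^sub>2 T T\<^sub>2 \<Longrightarrow> rt_steps nxt L (n\<^sub>1 + n\<^sub>2) T\<^sub>1 T\<^sub>2"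

inductive valid :: "('s \<Rightarrow> 's) \<Rightarrow> nat set \<Rightarrow> 's env \<Rightarrow> 's trm \<Rightarrow> bool"
  for nxt :: "'s \<Rightarrow> 's" and \<A> :: "nat set" where
  sort: "valid nxt \<A> L (Sort s)"
| var_0: "valid nxt \<A> K V \<Longrightarrow> valid nxt \<A> ((b, V) # K) (Var 0)"
| var_Suc: "valid nxt \<A> K (Var i) \<Longrightarrow> valid nxt \<A> ((b, V) # K) (Var (Suc i))"
| bind: "valid nxt \<A> L V \<Longrightarrow> valid nxt \<A> ((b, V) # L) T \<Longrightarrow> valid nxt \<A> L (Bind b V T)"
| cast: "valid nxt \<A> L U \<Longrightarrow> valid nxt \<A> L T \<Longrightarrow>
    rt_steps nxt L 1 T U\<^sub>0 \<Longrightarrow> rt_steps nxt L 0 U U\<^sub>0 \<Longrightarrow> valid nxt \<A> L (Cast U T)"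
| app: "valid nxt \<A> L V \<Longrightarrow> valid nxt \<A> L T \<Longrightarrow>
    n \<in> \<A> \<Longrightarrow> rt_steps nxt L n T (Lam W\<^sub>0 U\<^sub>0) \<Longrightarrow> rt_steps nxt L 1 V W\<^sub>0 \<Longrightarrow>
    valid nxt \<A> L (App V T)"

definition has_type :: "('s \<Rightarrow> 's) \<Rightarrow> nat set \<Rightarrow> 's env \<Rightarrow> 's trm \<Rightarrow> 's trm \<Rightarrow> bool" where
  "has_type nxt \<A> L T U \<longleftrightarrow> valid nxt \<A> L (Cast U T)"

datatype arity = Base | Arrow arity arity  \<comment> \<open>\<open>Arrow B A\<close> is \<open>B \<Rightarrow> A\<close>\<close>

inductive has_arity :: "'s env \<Rightarrow> 's trm \<Rightarrow> arity \<Rightarrow> bool" where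
  sort: "has_arity L (Sort s) Base"
| var_0: "has_arity K V A \<Longrightarrow> has_arity ((b, V) # K) (Var 0) A"
| var_Suc: "has_arity K (Var i) A \<Longrightarrow> has_arity ((b, V) # K) (Var (Suc i)) A"
| lam: "has_arity L W B \<Longrightarrow> has_arity ((Abst, W) # L) T A \<Longrightarrow> has_arity L (Lam W T) (Arrow B A)"
| def: "has_arity L V B \<Longrightarrow> has_arity ((Abbr, V) # L) T A \<Longrightarrow> has_arity L (Def V T) A"
| app: "has_arity L V B \<Longrightarrow> has_arity L T (Arrow B A) \<Longrightarrow> has_arity L (App V T) A"
| cast: "has_arity L U A \<Longrightarrow> has_arity L T A \<Longrightarrow> has_arity L (Cast U T) A"

end

(* Arity assignment is deterministic and is preserved by every rt-reduction step, whatever its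
   bound n: a term and its type have the same arity. Hence the two sides of the convertibility
   conditions of validity carry equal arities, so every valid term has an arity. *)
theory Submission
  imports Defs
begin

inductive_simps has_arity_simps [simp]:
  "has_arity L (Sort s) A"
  "has_arity ((b, V) # K) (Var 0) A"
  "has_arity ((b, V) # K) (Var (Suc i)) A"
  "has_arity L (Lam W T) A"
  "has_arity L (Def V T) A"
  "has_arity L (App V T) A"
  "has_arity L (Cast U T) A"

lemma has_arity_unique:
  assumes "has_arity L T A" and "has_arity L T B"
  shows "A = B"
  using assms
proof (induction arbitrary: B rule: has_arity.induct)
  case (lam L W B' T A)
  obtain B'' A'' where "B = Arrow B'' A''" "has_arity L W B''" "has_arity ((Abst, W) # L) T A''"
    using lam.prems by auto
  with lam.IH show ?case by blast
next
  case (app L V B' T A)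
  \<comment> \<open>The function's arity alone already fixes that of the application.\<close>
  obtain B'' where "has_arity L T (Arrow B'' B)"
    using app.prems by auto
  with app.IH(2) have "Arrow B' A = Arrow B'' B" by blast
  then show ?case by simp
qed (blast dest: has_arity_simps[THEN iffD1])+

text \<open>Comparing the environments only on variables, rather than inserting an entry at position
  \<open>d\<close>, gives a condition that passes under binders. Both directions matter:
  \<open>zeta\<close> removes a shift, while \<open>delta\<close>, \<open>decl\<close>,
  \<open>var\<close> and \<open>theta\<close> introduce one.\<close>

lemma has_arity_shift_iff:
  assumes "\<And>i A. has_arity L' (shift d (Var i)) A \<longleftrightarrow> has_arity L (Var i) A"
  shows "has_arity L' (shift d T) A \<longleftrightarrow> has_arity L T A"
  using assms
proof (induction T arbitrary: L L' d A)
  case (Bind b V T)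
  have V: "has_arity L' (shift d V) B \<longleftrightarrow> has_arity L V B" for B
    using Bind.IH(1) Bind.prems by blast
  \<comment> \<open>Index 0 stays fixed and gets its arity from the new entry; a successor reduces
    to the hypothesis for its predecessor.\<close>
  have "has_arity ((b, shift d V) # L') (shift (Suc d) (Var i)) B \<longleftrightarrow>
      has_arity ((b, V) # L) (Var i) B" for i B
    using V Bind.prems[of "i - 1"] by (cases i) (auto split: if_splits)
  then have "has_arity ((b, shift d V) # L') (shift (Suc d) T) B \<longleftrightarrow> has_arity ((b, V) # L) T B" for B
    by (rule Bind.IH(2))
  then show ?case
    using V by (cases b) auto
next
  case (Var i)
  then show ?case by blast
next
  case (App V T)
  then have "has_arity L' (shift d V) B \<longleftrightarrow> has_arity L V B"
    and "has_arity L' (shift d T) B \<longleftrightarrow> has_arity L T B" for B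
    by blast+
  then show ?case by simp
next
  case (Cast U T)
  then have "has_arity L' (shift d U) B \<longleftrightarrow> has_arity L U B"
    and "has_arity L' (shift d T) B \<longleftrightarrow> has_arity L T B" for B
    by blast+
  then show ?case by simp
qed simp

lemma has_arity_shift_0 [simp]: "has_arity ((b, V) # L) (shift 0 T) A \<longleftrightarrow> has_arity L T A"
  by (rule has_arity_shift_iff) simp

text \<open>An environment enters arity assignment only through the arities it gives to
  variables.\<close>

lemma has_arity_env_mono:
  assumes "has_arity L T A" and "\<And>i B. has_arity L (Var i) B \<Longrightarrow> has_arity L' (Var i) B"
  shows "has_arity L' T A"
  using assms
proof (induction T arbitrary: L L' A)
  case (Bind b V T)
  have V: "has_arity L V B \<Longrightarrow> has_arity L' V B" for B
    using Bind.IH(1) Bind.prems(2) by blast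
  have "has_arity ((b, V) # L) (Var i) B \<Longrightarrow> has_arity ((b, V) # L') (Var i) B" for i B
    using V Bind.prems(2) by (cases i) auto
  then have "has_arity ((b, V) # L) T B \<Longrightarrow> has_arity ((b, V) # L') T B" for B
    using Bind.IH(2) by blast
  then show ?case
    using V Bind.prems(1) by (cases b) auto
next
  case (App V T)
  from App.prems(1) obtain B where "has_arity L V B" "has_arity L T (Arrow B A)"
    by auto
  then have "has_arity L' V B" "has_arity L' T (Arrow B A)"
    using App.IH App.prems(2) by blast+
  then show ?case by auto
next
  case (Cast U T)
  from Cast.prems(1) have "has_arity L U A" "has_arity L T A"
    by auto
  then have "has_arity L' U A" "has_arity L' T A"
    using Cast.IH Cast.prems(2) by blast+
  then show ?case by simp
qed auto

text \<open>Arity assignment does not see the kind of an entry, which is what lets it survive the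
  \<open>\<beta>\<close>-step turning a declaration into a definition.\<close>

lemma has_arity_replace_entry:
  assumes "has_arity ((b, V) # L) T A" and "has_arity L V B" and "has_arity L V' B"
  shows "has_arity ((b', V') # L) T A"
proof (rule has_arity_env_mono[OF assms(1)])
  \<comment> \<open>The bound variable may have been used at any arity of \<open>V\<close>;
    uniqueness makes this the one shared with \<open>V'\<close>.\<close>
  have "C = B" if "has_arity L V C" for C
    using has_arity_unique that assms(2) by blast
  then show "has_arity ((b', V') # L) (Var i) C" if "has_arity ((b, V) # L) (Var i) C" for i C
    using that assms(3) by (cases i) auto
qed

text \<open>Steps of bound 1 are harmless: all sorts have arity \<open>Base\<close>, a declared
  variable has the arity of its type, and both parts of a cast share one arity.\<close>

lemma rt_step_has_arity:
  assumes "rt_step nxt L n T\<^sub>1 T\<^sub>2" and "has_arity L T\<^sub>1 A"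
  shows "has_arity L T\<^sub>2 A"
  using assms
proof (induction arbitrary: A rule: rt_step.induct)
  case (beta L V W T)
  then obtain B where "has_arity ((Abst, W) # L) T A" "has_arity L W B" "has_arity L V B"
    by auto
  \<comment> \<open>The abstraction forces \<open>W\<close> and \<open>V\<close> to share the arity
    \<open>B\<close>, so \<open>Cast W V\<close> has it too and may replace the entry
    \<open>W\<close>.\<close>
  then show ?case
    using has_arity_replace_entry[of Abst W L T A B "Cast W V" Abbr] by auto
next
  case (bind_left L V\<^sub>1 V\<^sub>2 b T)
  have "has_arity ((b, V\<^sub>2) # L) T C" if "has_arity ((b, V\<^sub>1) # L) T C" "has_arity L V\<^sub>1 B" for B C
    using has_arity_replace_entry that bind_left.IH by blast
  then show ?case
    using bind_left by (cases b) auto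
next
  case (bind_right b V L n T\<^sub>1 T\<^sub>2)
  then show ?case by (cases b) auto
qed auto

lemma rt_steps_has_arity:
  assumes "rt_steps nxt L n T\<^sub>1 T\<^sub>2" and "has_arity L T\<^sub>1 A"
  shows "has_arity L T\<^sub>2 A"
  using assms by (induction rule: rt_steps.induct) (blast dest: rt_step_has_arity)+

lemma valid_has_arity:
  assumes "valid nxt \<A> L T"
  shows "\<exists>A. has_arity L T A"
  using assms
proof (induction rule: valid.induct)
  case (bind L V b T)
  then show ?case by (cases b) auto
next
  case (cast L U T U\<^sub>0)
  then obtain A B where "has_arity L U A" and T: "has_arity L T B"
    by blast
  then have "has_arity L U\<^sub>0 A" "has_arity L U\<^sub>0 B"
    using rt_steps_has_arity cast.hyps by blast+
  then have "A = B"
    by (rule has_arity_unique)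
  with \<open>has_arity L U A\<close> T show ?case by auto
next
  case (app L V T n W\<^sub>0 U\<^sub>0)
  then obtain A B where V: "has_arity L V B" and T: "has_arity L T A"
    by blast
  \<comment> \<open>The arity of \<open>T\<close> is that of an abstraction it reduces to, hence an
    arrow whose domain is the arity of \<open>W\<^sub>0\<close>, which is also that of
    \<open>V\<close>.\<close>
  have "has_arity L (Lam W\<^sub>0 U\<^sub>0) A"
    by (rule rt_steps_has_arity) fact+
  then obtain A' B' where A: "A = Arrow B' A'" and "has_arity L W\<^sub>0 B'"
    by auto
  moreover have "has_arity L W\<^sub>0 B"
    by (rule rt_steps_has_arity) fact+
  ultimately have "B' = B"
    using has_arity_unique by blast
  with V T A show ?case by auto
qed auto

theorem theorem5p4:
  fixes nxt :: "'s \<Rightarrow> 's" and \<A> :: "nat set" and L :: "'s env" and T U :: "'s trm"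
  assumes "has_type nxt \<A> L T U"
  shows "\<exists>A. has_arity L T A \<and> has_arity L U A"
  \<comment> \<open>By inversion, an arity of \<open>Cast U T\<close> is one of both
    \<open>U\<close> and \<open>T\<close>.\<close>
  using assms valid_has_arity unfolding has_type_def by fastforce

end
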